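(* Let $\mathcal{A}$ be a class of unlabeled, unrooted trees (each tree $T\in\mathcal{A}$ having a size $|T|$, with finitely many trees of each size), with ordinary generating function $\mathcal{A}(z)=\sum_{T\in\mathcal{A}} z^{|T|}$. Let $\mathcal{A}^{\bullet}$ be the class of pairs $(T,v)$ with $T\in\mathcal{A}$ and $v$ a vertex of $T$, and $\mathcal{A}^{-}$ the class of pairs $(T,e)$ with $T\in\mathcal{A}$ and $e$ an (undirected) edge of $T$, where rooted trees are considered up to root-preserving isomorphism and $|(T,r)|:=|T|$; let $\mathcal{A}^{\bullet}(z)$, $\mathcal{A}^{-}(z)$ be their ordinary generating functions. Fix $z>0$ at which $\mathcal{A}^{\bullet}(z)$ and $\mathcal{A}^{-}(z)$ converge, with $\mathcal{A}(z)>0$, and suppose we have Boltzmann samplers $\Gamma\mathcal{A}^{\bullet}(z)$ and $\Gamma\mathcal{A}^{-}(z)$. Consider the procedure: repeat { with probability $\frac{\mathcal{A}^{\bullet}(z)}{\mathcal{A}^{\bullet}(z)+\mathcal{A}^{-}(z)}$ draw $(T,r)\leftarrow \Gamma\mathcal{A}^{\bullet}(z)$, otherwise draw $(T,r)\leftarrow\Gamma\mathcal{A}^{-}(z)$ } until $r=c(T)$; then return $T$. This procedure is a Boltzmann sampler for $\mathcal{A}$, i.e. it returns each $T\in\mathcal{A}$ with probability $z^{|T|}/\mathcal{A}(z)$.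
   Context: For an unlabeled class $\mathcal{C}$ with ordinary generating function $\mathcal{C}(z)=\sum_{\gamma\in\mathcal{C}}z^{|\gamma|}$ and a fixed $z>0$ at which $\mathcal{C}(z)$ converges, a Boltzmann sampler $\Gamma\mathcal{C}(z)$ is a random generator that outputs each $\gamma\in\mathcal{C}$ with probability $z^{|\gamma|}/\mathcal{C}(z)$. The center $c(T)$ of a tree $T$ is the vertex or edge of $T$ obtained by repeatedly deleting simultaneously all leaves of $T$ until fewer than 3 vertices remain; the result is either a single vertex or a single edge of $T$. The condition $r=c(T)$ means the marked vertex or edge of the drawn rooted tree is the center of $T$. *)

theory Defs
  imports "HOL-Probability.Probability"
begin

section \<open>Finite trees and their centers\<close>

text \<open>A graph is a pair of a vertex set and a set of two-element edges. Vertices are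
  natural numbers: every finite graph is isomorphic to one of this form, so all unlabeled
  finite trees are represented.\<close>

type_synonym graph = "nat set \<times> nat set set"

abbreviation verts :: "graph \<Rightarrow> nat set" where "verts \<equiv> fst"
abbreviation edges :: "graph \<Rightarrow> nat set set" where "edges \<equiv> snd"

definition finite_graph :: "graph \<Rightarrow> bool" where
  "finite_graph G \<longleftrightarrow> finite (verts G) \<and> (\<forall>e\<in>edges G. e \<subseteq> verts G \<and> card e = 2)"

definition connected_graph :: "graph \<Rightarrow> bool" where
  "connected_graph G \<longleftrightarrow>
     (\<forall>u\<in>verts G. \<forall>v\<in>verts G. (u, v) \<in> {(x, y). {x, y} \<in> edges G}\<^sup>*)"

definition is_cycle :: "graph \<Rightarrow> nat list \<Rightarrow> bool" where
  "is_cycle G p \<longleftrightarrow> 3 \<le> length p \<and> distinct p \<and>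
     (\<forall>i<length p. {p ! i, p ! (Suc i mod length p)} \<in> edges G)"

definition tree :: "graph \<Rightarrow> bool" where
  "tree G \<longleftrightarrow> finite_graph G \<and> verts G \<noteq> {} \<and> connected_graph G \<and> (\<nexists>p. is_cycle G p)"

definition leaves :: "graph \<Rightarrow> nat set" where
  "leaves G = {v \<in> verts G. card {e \<in> edges G. v \<in> e} = 1}"

definition delete_leaves :: "graph \<Rightarrow> graph" where
  "delete_leaves G = (verts G - leaves G, {e \<in> edges G. e \<inter> leaves G = {}})"

text \<open>The center is kept as the one-vertex or one-edge graph that remains.\<close>

definition center :: "graph \<Rightarrow> graph" where
  "center G =
     (delete_leaves ^^ (LEAST k. card (verts ((delete_leaves ^^ k) G)) < 3)) G"

section \<open>Isomorphism and unlabeled trees\<close>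

definition graph_iso :: "(nat \<Rightarrow> nat) \<Rightarrow> graph \<Rightarrow> graph \<Rightarrow> bool" where
  "graph_iso f G H \<longleftrightarrow>
     bij_betw f (verts G) (verts H) \<and> edges H = (\<lambda>e. f ` e) ` edges G"

datatype root = Vertex nat | Edge "nat set"

fun map_root :: "(nat \<Rightarrow> nat) \<Rightarrow> root \<Rightarrow> root" where
  "map_root f (Vertex v) = Vertex (f v)"
| "map_root f (Edge e) = Edge (f ` e)"

fun root_in :: "root \<Rightarrow> graph \<Rightarrow> bool" where
  "root_in (Vertex v) G \<longleftrightarrow> v \<in> verts G"
| "root_in (Edge e) G \<longleftrightarrow> e \<in> edges G"

fun root_graph :: "root \<Rightarrow> graph" where
  "root_graph (Vertex v) = ({v}, {})"
| "root_graph (Edge e) = (e, {e})"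

definition tree_iso :: "graph \<Rightarrow> graph \<Rightarrow> bool" where
  "tree_iso G H \<longleftrightarrow> tree G \<and> tree H \<and> (\<exists>f. graph_iso f G H)"

definition rooted_tree_iso :: "graph \<times> root \<Rightarrow> graph \<times> root \<Rightarrow> bool" where
  "rooted_tree_iso = (\<lambda>(G, r) (H, s). tree G \<and> tree H \<and> root_in r G \<and> root_in s H \<and>
     (\<exists>f. graph_iso f G H \<and> map_root f r = s))"

lemma graph_iso_sym:
  assumes "graph_iso f G H" "finite_graph G"
  shows "graph_iso (inv_into (verts G) f) H G"
proof -
  have inj: "inj_on f (verts G)" using assms(1) by (auto simp: graph_iso_def bij_betw_def)
  have "(\<lambda>e. inv_into (verts G) f ` e) ` edges H = edges G"
  proof -
    have "inv_into (verts G) f ` f ` e = e" if "e \<in> edges G" for e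
      using that inj assms(2) by (simp add: finite_graph_def)
    then show ?thesis using assms(1) by (force simp: graph_iso_def image_image)
  qed
  then show ?thesis using assms(1) by (auto simp: graph_iso_def bij_betw_inv_into)
qed

lemma map_root_inv_into:
  assumes "graph_iso f G H" "finite_graph G" "root_in r G"
  shows "map_root (inv_into (verts G) f) (map_root f r) = r"
  using assms
  by (cases r) (auto simp: graph_iso_def finite_graph_def bij_betw_def)

lemma graph_iso_trans:
  assumes "graph_iso f G H" "graph_iso g H K"
  shows "graph_iso (g \<circ> f) G K"
  using assms by (auto simp: graph_iso_def image_image image_comp intro: bij_betw_trans)

lemma map_root_comp: "map_root (g \<circ> f) r = map_root g (map_root f r)"
  by (cases r) (auto simp: image_comp)

lemma rooted_tree_iso_sym:
  assumes "rooted_tree_iso x y"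
  shows "rooted_tree_iso y x"
proof (cases x, cases y)
  fix G r H s assume xy: "x = (G, r)" "y = (H, s)"
  from assms xy obtain f where f: "graph_iso f G H" "map_root f r = s"
    and t: "tree G" "tree H" "root_in r G" "root_in s H"
    by (auto simp: rooted_tree_iso_def)
  have fin: "finite_graph G" using t by (simp add: tree_def)
  show ?thesis using graph_iso_sym[OF f(1) fin] map_root_inv_into[OF f(1) fin t(3)] f(2) t xy
    by (auto simp: rooted_tree_iso_def)
qed

lemma tree_singleton: "tree ({0}, {})"
  by (auto simp: tree_def finite_graph_def connected_graph_def is_cycle_def intro!: exI[of _ 0])

quotient_type utree = graph / partial: tree_iso
proof (rule part_equivpI)
  show "\<exists>x. tree_iso x x"
    by (rule exI[of _ "({0}, {})"])
       (auto simp: tree_iso_def tree_singleton graph_iso_def intro!: exI[of _ id])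
  show "symp tree_iso"
    unfolding symp_def tree_iso_def by (metis graph_iso_sym tree_def)
  show "transp tree_iso"
    unfolding transp_def tree_iso_def by (metis graph_iso_trans)
qed

quotient_type rtree = "graph \<times> root" / partial: rooted_tree_iso
proof (rule part_equivpI)
  show "\<exists>x. rooted_tree_iso x x"
    by (rule exI[of _ "(({0}, {}), Vertex 0)"])
       (auto simp: rooted_tree_iso_def tree_singleton graph_iso_def intro!: exI[of _ id])
  show "symp rooted_tree_iso"
    by (rule sympI) (rule rooted_tree_iso_sym)
  show "transp rooted_tree_iso"
  proof (rule transpI)
    fix x y w assume xy: "rooted_tree_iso x y" and yw: "rooted_tree_iso y w"
    obtain G r H s K t where p: "x = (G, r)" "y = (H, s)" "w = (K, t)"
      by (cases x, cases y, cases w)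
    obtain f where f: "graph_iso f G H" "map_root f r = s" "tree G" "root_in r G"
      using xy p by (auto simp: rooted_tree_iso_def)
    obtain g where g: "graph_iso g H K" "map_root g s = t" "tree K" "root_in t K"
      using yw p by (auto simp: rooted_tree_iso_def)
    show "rooted_tree_iso x w"
      using graph_iso_trans[OF f(1) g(1)] map_root_comp[of g f r] f g p
      by (auto simp: rooted_tree_iso_def)
  qed
qed

lift_definition unroot :: "rtree \<Rightarrow> utree" is fst
  by (auto simp: rooted_tree_iso_def tree_iso_def)

lemma delete_leaves_iso:
  assumes iso: "graph_iso f G H" and fin: "finite_graph G"
  shows "graph_iso f (delete_leaves G) (delete_leaves H)"
proof -
  have inj: "inj_on f (verts G)" and VH: "verts H = f ` verts G"
    and EH: "edges H = (\<lambda>e. f ` e) ` edges G"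
    using iso by (auto simp: graph_iso_def bij_betw_def)
  have sub: "e \<subseteq> verts G" if "e \<in> edges G" for e using fin that by (auto simp: finite_graph_def)
  have inj2: "inj_on (\<lambda>e. f ` e) (edges G)"
    by (rule inj_onI) (metis inj sub inj_on_image_eq_iff)
  have deg: "card {e \<in> edges H. f v \<in> e} = card {e \<in> edges G. v \<in> e}" if "v \<in> verts G" for v
  proof -
    have "{e \<in> edges H. f v \<in> e} = (\<lambda>e. f ` e) ` {e \<in> edges G. v \<in> e}"
      unfolding EH using inj_on_image_mem_iff[OF inj that sub] by auto
    moreover have "inj_on (\<lambda>e. f ` e) {e \<in> edges G. v \<in> e}"
      using inj2 by (rule inj_on_subset) auto
    ultimately show ?thesis by (simp add: card_image)
  qed
  have lv: "leaves H = f ` leaves G"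
    using deg by (auto simp: leaves_def VH)
  have lsub: "leaves G \<subseteq> verts G" by (auto simp: leaves_def)
  have 1: "verts H - leaves H = f ` (verts G - leaves G)"
    unfolding VH lv using inj lsub by (metis Diff_subset inj_on_image_set_diff)
  have disj: "f ` e \<inter> f ` leaves G = {} \<longleftrightarrow> e \<inter> leaves G = {}" if "e \<in> edges G" for e
    using inj_on_image_Int[OF inj sub[OF that] lsub] by (metis image_is_empty)
  have 2: "{e \<in> edges H. e \<inter> leaves H = {}} = (\<lambda>e. f ` e) ` {e \<in> edges G. e \<inter> leaves G = {}}"
    unfolding EH lv using disj by auto
  have "inj_on f (verts G - leaves G)" using inj by (rule inj_on_subset) auto
  then show ?thesis by (simp add: graph_iso_def delete_leaves_def bij_betw_def 1 2)
qed

lemma finite_graph_delete_leaves: "finite_graph G \<Longrightarrow> finite_graph (delete_leaves G)"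
  by (auto simp: finite_graph_def delete_leaves_def)

lemma center_iso:
  assumes "graph_iso f G H" "finite_graph G"
  shows "graph_iso f (center G) (center H)"
proof -
  have *: "graph_iso f ((delete_leaves ^^ k) G) ((delete_leaves ^^ k) H) \<and>
      finite_graph ((delete_leaves ^^ k) G)" for k
    by (induction k) (auto simp: assms delete_leaves_iso finite_graph_delete_leaves)
  have "card (verts ((delete_leaves ^^ k) G)) = card (verts ((delete_leaves ^^ k) H))" for k
    using *[of k] by (auto simp: graph_iso_def dest: bij_betw_same_card)
  then show ?thesis using * by (simp add: center_def)
qed

lemma root_graph_iso:
  "graph_iso f (root_graph r) G \<Longrightarrow> root_graph (map_root f r) = G"
  by (cases r; cases G) (auto simp: graph_iso_def bij_betw_def)

lift_definition center_rooted :: "rtree \<Rightarrow> bool" is "\<lambda>(G, r). root_graph r = center G"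
proof -
  have imp: "root_graph s = center H"
    if iso: "rooted_tree_iso (G, r) (H, s)" and r: "root_graph r = center G" for G r H s
  proof -
    obtain f where f: "graph_iso f G H" "map_root f r = s" and "finite_graph G"
      using iso by (auto simp: rooted_tree_iso_def tree_def)
    then have "graph_iso f (root_graph r) (center H)"
      unfolding r by (intro center_iso)
    then show ?thesis using root_graph_iso f(2) by blast
  qed
  fix x y assume xy: "rooted_tree_iso x y"
  obtain G r H s where p: "x = (G, r)" "y = (H, s)" by (cases x, cases y)
  show "(case x of (G, r) \<Rightarrow> root_graph r = center G) =
        (case y of (G, r) \<Rightarrow> root_graph r = center G)"
    using imp xy rooted_tree_iso_sym[OF xy] unfolding p prod.case by blast
qed

definition vertex_rootings :: "utree set \<Rightarrow> rtree set" where
  "vertex_rootings A =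
     {abs_rtree (G, Vertex v) | G v. tree G \<and> abs_utree G \<in> A \<and> v \<in> verts G}"

definition edge_rootings :: "utree set \<Rightarrow> rtree set" where
  "edge_rootings A =
     {abs_rtree (G, Edge e) | G e. tree G \<and> abs_utree G \<in> A \<and> e \<in> edges G}"

section \<open>Boltzmann samplers and the rejection procedure\<close>

definition ogf :: "'a set \<Rightarrow> ('a \<Rightarrow> nat) \<Rightarrow> real \<Rightarrow> real" where
  "ogf C sz z = (\<Sum>\<^sub>\<infinity>\<gamma>\<in>C. z ^ sz \<gamma>)"

text \<open>If \<open>C\<close> is nonempty and its generating function converges at \<open>z > 0\<close>, the prescribed
  probabilities sum to 1, so a sampler terminates almost surely with a result in \<open>C\<close>.
  For empty \<open>C\<close> (such as the edge rootings of the one-vertex tree) there is no condition;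
  the procedure below then selects that sampler with probability 0.\<close>

definition boltzmann_sampler :: "'a set \<Rightarrow> ('a \<Rightarrow> nat) \<Rightarrow> real \<Rightarrow> 'a spmf \<Rightarrow> bool" where
  "boltzmann_sampler C sz z p \<longleftrightarrow> (\<forall>\<gamma>\<in>C. spmf p \<gamma> = z ^ sz \<gamma> / ogf C sz z)"

partial_function (spmf) repeat_until :: "'a spmf \<Rightarrow> ('a \<Rightarrow> bool) \<Rightarrow> 'a spmf" where
  "repeat_until p P =
     bind_spmf p (\<lambda>x. if P x then return_spmf x else repeat_until p P)"

definition center_rejection :: "real \<Rightarrow> rtree spmf \<Rightarrow> rtree spmf \<Rightarrow> utree spmf" where
  "center_rejection q \<Gamma>v \<Gamma>e =
     map_spmf unroot
       (repeat_until
         (bind_spmf (spmf_of_pmf (bernoulli_pmf q)) (\<lambda>b. if b then \<Gamma>v else \<Gamma>e))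
         center_rooted)"

end

theory Submission imports Defs begin

text \<open>
  Pruning the leaves of a tree with at least three vertices gives a strictly smaller tree, so the
  center exists and is preserved by isomorphisms. Hence every unlabeled tree arises from exactly one
  of its rootings with the root at the center. The mixture of the two samplers is a Boltzmann
  sampler for the disjoint union of the vertex and edge rootings, and rejection turns it into one for
  the center-rooted trees, which forgetting the root carries bijectively onto \<open>A\<close>.
\<close>

section \<open>Centers of trees\<close>

text \<open>Grow a path at its head. The head has an edge but is no leaf, so it has a neighbour
  other than the second vertex of the path; that neighbour is new, since meeting the path again
  would close a cycle.\<close>

lemma no_leaf_long_path:
  assumes fin: "finite_graph G" and acyc: "\<nexists>p. is_cycle G p"
    and deg: "\<And>v. v \<in> verts G \<Longrightarrow> \<exists>w. {v, w} \<in> edges G"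
    and no_leaf: "leaves G = {}" and ne: "verts G \<noteq> {}"
  shows "\<exists>p. length p = Suc n \<and> distinct p \<and> set p \<subseteq> verts G \<and>
    (\<forall>i. Suc i < length p \<longrightarrow> {p ! i, p ! Suc i} \<in> edges G)"
proof (induction n)
  case 0
  obtain v where "v \<in> verts G" using ne by auto
  then show ?case by (intro exI[of _ "[v]"]) auto
next
  case (Suc n)
  then obtain p where p: "length p = Suc n" "distinct p" "set p \<subseteq> verts G"
    and path: "\<And>i. Suc i < length p \<Longrightarrow> {p ! i, p ! Suc i} \<in> edges G" by blast
  then obtain v q where vq: "p = v # q" by (cases p) auto
  have v: "v \<in> verts G" using p vq by auto
  have edge: "x \<in> verts G \<and> y \<in> verts G \<and> x \<noteq> y" if "{x, y} \<in> edges G" for x y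
    using fin that by (force simp: finite_graph_def card_insert_if)
  \<comment> \<open>If \<open>q\<close> is empty, \<open>hd q\<close> is an arbitrary value; the
    claim still holds, because \<open>v\<close> has two neighbours and only one value is
    excluded.\<close>
  have "\<exists>u. {v, u} \<in> edges G \<and> u \<notin> {hd q}"
  proof (rule ccontr)
    assume no: "\<not> ?thesis"
    obtain w where w: "{v, w} \<in> edges G" using deg v by blast
    have "e = {v, w}" if "e \<in> edges G" "v \<in> e" for e
    proof -
      have "card e = 2" using fin that by (auto simp: finite_graph_def)
      then obtain a b where "e = {a, b}" by (auto simp: card_2_iff)
      then obtain c where c: "e = {v, c}"
        using \<open>v \<in> e\<close> by (metis insert_commute insertE singletonD)
      then show ?thesis using no w that by auto
    qed
    then have "{e \<in> edges G. v \<in> e} = {{v, w}}" using w by blast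
    then have "v \<in> leaves G" using v by (simp add: leaves_def)
    then show False using no_leaf by simp
  qed
  then obtain u where u: "{v, u} \<in> edges G" "u \<noteq> hd q" by blast
  have "u \<notin> set p"
  proof
    assume "u \<in> set p"
    then obtain i where i: "i < length p" "p ! i = u" by (auto simp: in_set_conv_nth)
    have "i \<noteq> 0" using edge[OF u(1)] i vq by (cases i) auto
    moreover have "i \<noteq> 1" using u(2) i vq by (cases q) auto
    ultimately have i2: "2 \<le> i" by linarith
    have len: "length (take (Suc i) p) = Suc i" using i by simp
    \<comment> \<open>The edge from \<open>u\<close> back to \<open>v\<close> closes the initial
      segment ending in \<open>u\<close>; the index wraps around only at
      \<open>j = i\<close>.\<close>
    have "is_cycle G (take (Suc i) p)"
      unfolding is_cycle_def len
    proof (intro conjI allI impI)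
      show "3 \<le> Suc i" using i2 by simp
      show "distinct (take (Suc i) p)" using p(2) by simp
      fix j assume j: "j < Suc i"
      show "{take (Suc i) p ! j, take (Suc i) p ! (Suc j mod Suc i)} \<in> edges G"
      proof (cases "j = i")
        case True
        have "take (Suc i) p ! i = u" using i by simp
        moreover have "take (Suc i) p ! 0 = v" using vq by simp
        ultimately show ?thesis using u(1) True by (simp add: insert_commute)
      next
        case False
        then have "Suc j < Suc i" using j by simp
        then show ?thesis using path[of j] i by simp
      qed
    qed
    then show False using acyc by blast
  qed
  moreover have "{(u # p) ! i, (u # p) ! Suc i} \<in> edges G" if "Suc i < length (u # p)" for i
    using that path u vq by (cases i) (auto simp: insert_commute)
  ultimately show ?case using p edge[OF u(1)]
    by (intro exI[of _ "u # p"]) auto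
qed

section \<open>Leaves of trees and their removal\<close>

lemma tree_edgeD:
  assumes "tree G" "{x, y} \<in> edges G"
  shows "x \<in> verts G" "y \<in> verts G" "x \<noteq> y"
  using assms by (force simp: tree_def finite_graph_def card_insert_if)+

text \<open>Induction along a walk from \<open>v\<close>. It is applied to sets of one or two
  vertices without outgoing edges, which must then exhaust the tree.\<close>

lemma tree_closed_set:
  assumes T: "tree G" and v: "v \<in> S" "v \<in> verts G"
    and closed: "\<And>x y. x \<in> S \<Longrightarrow> {x, y} \<in> edges G \<Longrightarrow> y \<in> S"
  shows "verts G \<subseteq> S"
proof
  fix u assume "u \<in> verts G"
  then have "(v, u) \<in> {(x, y). {x, y} \<in> edges G}\<^sup>*"
    using T v by (auto simp: tree_def connected_graph_def)
  then show "u \<in> S" by induction (use v closed in auto)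
qed

lemma tree_neighbour:
  assumes T: "tree G" and "2 \<le> card (verts G)" and v: "v \<in> verts G"
  shows "\<exists>w. {v, w} \<in> edges G"
proof (rule ccontr)
  assume "\<not> ?thesis"
  then have "verts G \<subseteq> {v}" using tree_closed_set[OF T _ v, of "{v}"] by auto
  then have "card (verts G) \<le> card {v}" by (intro card_mono) auto
  then show False using assms(2) by simp
qed

text \<open>Otherwise \<open>no_leaf_long_path\<close> would give a path with more vertices than the
  tree has.\<close>

lemma tree_has_leaf:
  assumes T: "tree G" and "2 \<le> card (verts G)"
  shows "leaves G \<noteq> {}"
proof
  assume "leaves G = {}"
  then obtain p where p: "length p = Suc (card (verts G))" "distinct p" "set p \<subseteq> verts G"
    using no_leaf_long_path[of G "card (verts G)"] tree_neighbour[OF assms] T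
    unfolding tree_def by metis
  have "card (set p) \<le> card (verts G)"
    using p(3) T by (intro card_mono) (auto simp: tree_def finite_graph_def)
  then show False using p(1,2) by (simp add: distinct_card)
qed

lemma leaf_neighbour_unique:
  assumes "v \<in> leaves G" "{v, x} \<in> edges G" "{v, y} \<in> edges G"
  shows "x = y"
proof -
  obtain e where "{e \<in> edges G. v \<in> e} = {e}"
    using assms(1) by (auto simp: leaves_def card_1_singleton_iff)
  moreover have "{v, x} \<in> {e \<in> edges G. v \<in> e}" "{v, y} \<in> {e \<in> edges G. v \<in> e}"
    using assms(2,3) by simp_all
  ultimately have "{v, x} = {v, y}" by simp
  then show ?thesis by (auto simp: doubleton_eq_iff)
qed

text \<open>Two adjacent leaves have only each other as neighbours, so they would be the whole tree.
  A single edge shows that the bound 3 is sharp.\<close>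

lemma leaves_not_adjacent:
  assumes T: "tree G" and big: "3 \<le> card (verts G)" and e: "{x, y} \<in> edges G"
  shows "x \<notin> leaves G \<or> y \<notin> leaves G"
proof (rule ccontr)
  assume "\<not> ?thesis"
  then have lx: "x \<in> leaves G" and ly: "y \<in> leaves G" by auto
  have "{y, x} \<in> edges G" using e by (simp add: insert_commute)
  then have "\<And>w. {x, w} \<in> edges G \<Longrightarrow> w = y" "\<And>w. {y, w} \<in> edges G \<Longrightarrow> w = x"
    using leaf_neighbour_unique[OF lx _ e] leaf_neighbour_unique[OF ly] by auto
  then have "verts G \<subseteq> {x, y}"
    using tree_closed_set[OF T _ tree_edgeD(1)[OF T e], of "{x, y}"] by blast
  then have "card (verts G) \<le> card {x, y}" by (intro card_mono) auto
  then show False using big card_insert_le_m1[of 2 "{y}" x] by simp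
qed

text \<open>A cycle in the remainder is a cycle in \<open>G\<close>, and some edge has an end that
  is not a leaf, so the remainder is acyclic and nonempty. Connectedness is the main work.\<close>

lemma tree_delete_leaves:
  assumes T: "tree G" and big: "3 \<le> card (verts G)"
  shows "tree (delete_leaves G)"
proof -
  let ?D = "delete_leaves G"
  \<comment> \<open>Sending each leaf to its neighbour retracts the tree onto what remains, so walks map to walks.\<close>
  define r where "r v = (if v \<in> leaves G then SOME w. {v, w} \<in> edges G else v)" for v
  have r_leaf: "r x = y" if "x \<in> leaves G" "{x, y} \<in> edges G" for x y
    using leaf_neighbour_unique[OF that(1) _ that(2)] someI[of "\<lambda>w. {x, w} \<in> edges G", OF that(2)] that(1)
    unfolding r_def by simp
  have edge_D: "{x, y} \<in> edges ?D \<longleftrightarrow> {x, y} \<in> edges G \<and> x \<notin> leaves G \<and> y \<notin> leaves G" for x y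
    by (auto simp: delete_leaves_def)
  \<comment> \<open>An edge with a leaf end collapses to a single vertex, which the reflexive
    closure absorbs; an edge without leaf ends survives.\<close>
  have step: "(r x, r y) \<in> {(x, y). {x, y} \<in> edges ?D}\<^sup>*" if e: "{x, y} \<in> edges G" for x y
  proof -
    consider "x \<in> leaves G" "y \<notin> leaves G" | "x \<notin> leaves G" "y \<in> leaves G"
      | "x \<notin> leaves G" "y \<notin> leaves G"
      using leaves_not_adjacent[OF T big e] by blast
    then show ?thesis
    proof cases
      case 1 then show ?thesis using r_leaf e by (simp add: r_def)
    next
      case 2 then show ?thesis using r_leaf[of y x] e by (simp add: r_def insert_commute)
    next
      case 3 then show ?thesis using e edge_D by (auto simp: r_def)
    qed
  qed
  have walk: "(r x, r y) \<in> {(x, y). {x, y} \<in> edges ?D}\<^sup>*"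
    if "(x, y) \<in> {(x, y). {x, y} \<in> edges G}\<^sup>*" for x y
    using that by induction (auto intro: rtrancl_trans step)
  have conn: "connected_graph ?D"
    unfolding connected_graph_def
  proof (intro ballI)
    fix u v assume "u \<in> verts ?D" "v \<in> verts ?D"
    then have uv: "u \<in> verts G" "u \<notin> leaves G" "v \<in> verts G" "v \<notin> leaves G"
      by (auto simp: delete_leaves_def)
    then have "(r u, r v) \<in> {(x, y). {x, y} \<in> edges ?D}\<^sup>*"
      using T by (intro walk) (auto simp: tree_def connected_graph_def)
    then show "(u, v) \<in> {(x, y). {x, y} \<in> edges ?D}\<^sup>*" using uv by (simp add: r_def)
  qed
  have "\<exists>v. v \<in> verts G \<and> v \<notin> leaves G"
  proof -
    obtain v where v: "v \<in> verts G" using T by (auto simp: tree_def)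
    obtain w where w: "{v, w} \<in> edges G" using tree_neighbour[OF T _ v] big by auto
    show ?thesis using tree_edgeD[OF T w] leaves_not_adjacent[OF T big w] by blast
  qed
  then have ne: "verts ?D \<noteq> {}" by (auto simp: delete_leaves_def)
  have "is_cycle G p" if "is_cycle ?D p" for p
    using that by (auto simp: is_cycle_def delete_leaves_def)
  then show ?thesis using T conn ne finite_graph_delete_leaves by (auto simp: tree_def)
qed

lemma card_delete_leaves_less:
  assumes T: "tree G" and "2 \<le> card (verts G)"
  shows "card (verts (delete_leaves G)) < card (verts G)"
proof -
  have "verts (delete_leaves G) \<subset> verts G"
    using tree_has_leaf[OF assms] by (auto simp: delete_leaves_def leaves_def)
  then show ?thesis using T by (intro psubset_card_mono) (auto simp: tree_def finite_graph_def)
qed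

section \<open>Iterated pruning and the center\<close>

text \<open>Each round that starts with at least three vertices keeps a tree and removes at least
  one vertex, so the number of such rounds is bounded.\<close>

lemma iterated_delete_leaves:
  assumes T: "tree G" and big: "\<forall>j<k. 3 \<le> card (verts ((delete_leaves ^^ j) G))"
  shows "tree ((delete_leaves ^^ k) G) \<and> card (verts ((delete_leaves ^^ k) G)) + k \<le> card (verts G)"
  using big
proof (induction k)
  case 0
  then show ?case using T by simp
next
  case (Suc k)
  then have IH: "tree ((delete_leaves ^^ k) G)"
    "card (verts ((delete_leaves ^^ k) G)) + k \<le> card (verts G)"
    and b: "3 \<le> card (verts ((delete_leaves ^^ k) G))" by auto
  show ?case using tree_delete_leaves[OF IH(1) b] card_delete_leaves_less[OF IH(1)] b IH(2) by simp
qed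

text \<open>Links the graph left by pruning to the datatype \<open>root\<close>: one vertex gives a
  \<open>Vertex\<close>, and with two vertices the only edge is the whole vertex set.\<close>

lemma small_tree:
  assumes T: "tree G" and small: "card (verts G) < 3"
  shows "\<exists>r. root_in r G \<and> root_graph r = G"
proof -
  have fin: "finite (verts G)" "verts G \<noteq> {}" using T by (auto simp: tree_def finite_graph_def)
  have E: "e \<subseteq> verts G" "card e = 2" if "e \<in> edges G" for e
    using T that by (auto simp: tree_def finite_graph_def)
  from fin have "card (verts G) \<noteq> 0" by simp
  then consider "card (verts G) = 1" | "card (verts G) = 2" using small by linarith
  then show ?thesis
  proof cases
    case 1
    then obtain v where v: "verts G = {v}" by (auto simp: card_1_singleton_iff)
    have "edges G = {}"
    proof (rule ccontr)
      assume "edges G \<noteq> {}"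
      then obtain e where "e \<in> edges G" by blast
      then have "card e = 2" "card e \<le> card {v}"
        using E[of e] v card_mono[of "{v}" e] by simp_all
      then show False by simp
    qed
    then show ?thesis using v by (intro exI[of _ "Vertex v"]) (cases G, auto)
  next
    case 2
    have eq: "e = verts G" if "e \<in> edges G" for e
      using E[OF that] fin 2 by (metis card_subset_eq)
    obtain v where "v \<in> verts G" using fin by auto
    then obtain w where "{v, w} \<in> edges G" using tree_neighbour[OF T] 2 by auto
    then have "edges G = {verts G}" using eq by auto
    then show ?thesis by (intro exI[of _ "Edge (verts G)"]) (cases G, auto)
  qed
qed

lemma center_root_exists:
  assumes T: "tree G"
  shows "\<exists>r. root_in r G \<and> root_graph r = center G"
proof -
  let ?small = "\<lambda>k. card (verts ((delete_leaves ^^ k) G)) < 3"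
  \<comment> \<open>If each of the first \<open>Suc (card (verts G))\<close> stages had at least
    three vertices, more vertices would have been removed than \<open>G\<close> has.\<close>
  have "\<exists>k. ?small k"
    using iterated_delete_leaves[OF T, of "Suc (card (verts G))"] by (force simp: not_less)
  then have "?small (LEAST k. ?small k)" by (rule LeastI_ex)
  moreover have "tree (center G)"
    unfolding center_def
    using iterated_delete_leaves[OF T, of "LEAST k. ?small k"] not_less_Least[of _ ?small]
    by (auto simp: not_less)
  ultimately obtain r where r: "root_in r (center G)" "root_graph r = center G"
    using small_tree[of "center G"] unfolding center_def by blast
  \<comment> \<open>Pruning only discards vertices and edges, so a root found in the center is also
    a root of \<open>G\<close>.\<close>
  have "verts ((delete_leaves ^^ k) G) \<subseteq> verts G \<and> edges ((delete_leaves ^^ k) G) \<subseteq> edges G" for k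
    by (induction k) (auto simp: delete_leaves_def)
  then have "verts (center G) \<subseteq> verts G" "edges (center G) \<subseteq> edges G"
    by (auto simp: center_def)
  with r show ?thesis by (cases r) (auto intro!: exI[of _ r])
qed

section \<open>Center-rooted trees\<close>

lemma root_graph_inject: "root_graph r = root_graph s \<longleftrightarrow> r = s"
  by (cases r; cases s) auto

lemma rooted_tree_iso_refl: "tree G \<Longrightarrow> root_in r G \<Longrightarrow> rooted_tree_iso (G, r) (G, r)"
  by (cases r) (auto simp: rooted_tree_iso_def graph_iso_def intro!: exI[of _ id])

text \<open>The quotient is partial, so both representatives must be shown to lie in the domain of
  the relation before equality of classes gives an isomorphism.\<close>

lemma abs_rtree_eq_iff:
  assumes "tree G" "root_in r G" "tree H" "root_in s H"
  shows "abs_rtree (G, r) = abs_rtree (H, s) \<longleftrightarrow> rooted_tree_iso (G, r) (H, s)"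
  using Quotient_rel[OF Quotient_rtree, of "(G, r)" "(H, s)"] assms rooted_tree_iso_refl by blast

lemma abs_utree_eqD:
  assumes "tree G" "tree H" "abs_utree G = abs_utree H"
  obtains f where "graph_iso f G H"
proof -
  have "tree_iso K K" if "tree K" for K
    using that by (auto simp: tree_iso_def graph_iso_def intro!: exI[of _ id])
  then have "tree_iso G H" using Quotient_rel[OF Quotient_utree, of G H] assms by blast
  then show ?thesis using that by (auto simp: tree_iso_def)
qed

lemma abs_rtree_cases:
  obtains G r where "\<rho> = abs_rtree (G, r)" "tree G" "root_in r G"
proof -
  have "\<exists>G r. \<rho> = abs_rtree (G, r) \<and> tree G \<and> root_in r G"
    by (induction \<rho> rule: rtree.abs_induct) (auto simp: rooted_tree_iso_def)
  then show ?thesis using that by blast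
qed

lemma abs_utree_cases:
  obtains G where "T = abs_utree G" "tree G"
proof -
  have "\<exists>G. T = abs_utree G \<and> tree G"
    by (induction T rule: utree.abs_induct) (auto simp: tree_iso_def)
  then show ?thesis using that by blast
qed

lemma unroot_abs_rtree: "tree G \<Longrightarrow> root_in r G \<Longrightarrow> unroot (abs_rtree (G, r)) = abs_utree G"
  using unroot.abs_eq rooted_tree_iso_refl by fastforce

lemma center_rooted_abs_rtree:
  "tree G \<Longrightarrow> root_in r G \<Longrightarrow> center_rooted (abs_rtree (G, r)) \<longleftrightarrow> root_graph r = center G"
  using center_rooted.abs_eq rooted_tree_iso_refl by fastforce

text \<open>Any isomorphism of the underlying trees carries center to center, hence root to root,
  and so is already an isomorphism of the rooted trees.\<close>

lemma inj_on_unroot_center_rooted: "inj_on unroot {\<rho>. center_rooted \<rho>}"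
proof (rule inj_onI, unfold mem_Collect_eq)
  fix \<rho> \<sigma> assume c: "center_rooted \<rho>" "center_rooted \<sigma>" and eq: "unroot \<rho> = unroot \<sigma>"
  obtain G r where \<rho>: "\<rho> = abs_rtree (G, r)" "tree G" "root_in r G" by (rule abs_rtree_cases)
  obtain H s where \<sigma>: "\<sigma> = abs_rtree (H, s)" "tree H" "root_in s H" by (rule abs_rtree_cases)
  obtain f where f: "graph_iso f G H"
    using eq \<rho> \<sigma> by (auto simp: unroot_abs_rtree elim: abs_utree_eqD)
  have "finite_graph G" using \<rho>(2) by (simp add: tree_def)
  then have "graph_iso f (root_graph r) (root_graph s)"
    using center_iso[OF f] c \<rho> \<sigma> by (simp add: center_rooted_abs_rtree)
  then have "map_root f r = s" using root_graph_iso root_graph_inject by blast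
  then have "rooted_tree_iso (G, r) (H, s)" using f \<rho> \<sigma> by (auto simp: rooted_tree_iso_def)
  then show "\<rho> = \<sigma>" using \<rho> \<sigma> abs_rtree_eq_iff by simp
qed

text \<open>\<open>map_root\<close> preserves the constructor of the root. Disjointness is what lets
  the two generating functions add up.\<close>

lemma vertex_edge_rootings_disjoint: "vertex_rootings A \<inter> edge_rootings A = {}"
proof -
  have "abs_rtree (G, Vertex v) \<noteq> abs_rtree (H, Edge e)"
    if "tree G" "v \<in> verts G" "tree H" "e \<in> edges H" for G v H e
    using that by (subst abs_rtree_eq_iff) (auto simp: rooted_tree_iso_def)
  then show ?thesis unfolding vertex_rootings_def edge_rootings_def by blast
qed

text \<open>Uniqueness of the rooting comes from invariance of the center under isomorphism,
  existence from \<open>center_root_exists\<close>.\<close>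

lemma bij_betw_unroot_center_rooted:
  "bij_betw unroot {\<rho> \<in> vertex_rootings A \<union> edge_rootings A. center_rooted \<rho>} A"
  unfolding bij_betw_def
proof
  let ?S = "{\<rho> \<in> vertex_rootings A \<union> edge_rootings A. center_rooted \<rho>}"
  show "inj_on unroot ?S" by (rule inj_on_subset[OF inj_on_unroot_center_rooted]) auto
  show "unroot ` ?S = A"
  proof
    show "unroot ` ?S \<subseteq> A"
      by (auto simp: vertex_rootings_def edge_rootings_def unroot_abs_rtree)
    show "A \<subseteq> unroot ` ?S"
    proof
      fix T assume T: "T \<in> A"
      obtain G where G: "T = abs_utree G" "tree G" by (rule abs_utree_cases)
      obtain r where r: "root_in r G" "root_graph r = center G"
        using center_root_exists[OF G(2)] by blast
      have "abs_rtree (G, r) \<in> vertex_rootings A \<union> edge_rootings A"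
      proof (cases r)
        case (Vertex v)
        then show ?thesis using r(1) G T unfolding vertex_rootings_def by fastforce
      next
        case (Edge e)
        then show ?thesis using r(1) G T unfolding edge_rootings_def by fastforce
      qed
      then show "T \<in> unroot ` ?S"
        using r G unroot_abs_rtree[OF G(2) r(1)] center_rooted_abs_rtree[OF G(2) r(1)]
        by (intro image_eqI[of _ _ "abs_rtree (G, r)"]) auto
    qed
  qed
qed

section \<open>Rejection sampling\<close>

text \<open>Bridge from probabilities as measures to the infinite sums in \<open>ogf\<close>,
  obtained from the \<open>pmf\<close> on the option type by reindexing along
  \<open>Some\<close>.\<close>

lemma has_sum_spmf: "(spmf p has_sum measure (measure_spmf p) S) S"
proof -
  have "pmf p summable_on Some ` S"
    using abs_summable_equivalent[of "pmf p"] pmf_abs_summable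
    by (metis abs_summable_summable)
  moreover have "infsum (pmf p) (Some ` S) = measure (measure_spmf p) S"
    by (simp add: measure_measure_spmf_conv_measure_pmf measure_pmf_conv_infsetsum
        infsetsum_infsum pmf_abs_summable)
  ultimately have "(pmf p has_sum measure (measure_spmf p) S) (Some ` S)"
    by (metis has_sum_infsum)
  then show ?thesis by (subst (asm) has_sum_reindex) (auto simp: o_def)
qed

text \<open>Unfold the loop once: either the first draw is accepted and is \<open>x\<close>, or it
  is rejected and the loop starts afresh. The product form stays valid when draws are rejected with
  probability 1.\<close>

lemma spmf_repeat_until:
  "spmf (repeat_until p P) x * (1 - measure (measure_spmf p) {y. \<not> P y}) =
    (if P x then spmf p x else 0)"
proof -
  let ?F = "repeat_until p P"
  have "spmf ?F x = (\<integral>y. spmf (if P y then return_spmf y else ?F) x \<partial>measure_spmf p)"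
    by (subst repeat_until.simps) (rule spmf_bind)
  \<comment> \<open>The first indicator is the event that this round returns \<open>x\<close>, the
    second that it is rejected.\<close>
  also have "\<dots> = (\<integral>y. indicator (if P x then {x} else {}) y + indicator {y. \<not> P y} y * spmf ?F x
      \<partial>measure_spmf p)"
    by (intro Bochner_Integration.integral_cong) (auto simp: indicator_def)
  also have "\<dots> = measure (measure_spmf p) (if P x then {x} else {}) +
      measure (measure_spmf p) {y. \<not> P y} * spmf ?F x"
    by (subst Bochner_Integration.integral_add)
      (auto simp: measure_spmf.emeasure_eq_measure intro!: integrable_mult_left)
  finally have "spmf ?F x = (if P x then spmf p x else 0) +
      measure (measure_spmf p) {y. \<not> P y} * spmf ?F x"
    by (simp add: spmf_conv_measure_spmf split: if_splits)
  then show ?thesis by (simp only: algebra_simps)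
qed

section \<open>Normalization, mixing and conditioning of Boltzmann samplers\<close>

text \<open>A convergent sum of nonnegative terms vanishes only if every term does. Convergence
  matters: \<open>infsum\<close> is 0 by convention on families that are not summable.\<close>

lemma ogf_pos:
  assumes "z > 0" "(\<lambda>\<gamma>. z ^ sz \<gamma>) summable_on C" "C \<noteq> {}"
  shows "ogf C sz z > 0"
proof -
  obtain \<gamma> where "\<gamma> \<in> C" using assms(3) by auto
  then have "ogf C sz z \<noteq> 0"
    using nonneg_infsum_le_0D[OF _ assms(2), of \<gamma>] assms(1) unfolding ogf_def by force
  moreover have "ogf C sz z \<ge> 0" using assms(1) unfolding ogf_def by (intro infsum_nonneg) auto
  ultimately show ?thesis by simp
qed

lemma boltzmann_sampler_measure:
  assumes samp: "boltzmann_sampler C sz z p" and S: "S \<subseteq> C"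
  shows "measure (measure_spmf p) S = ogf S sz z / ogf C sz z"
proof -
  have "measure (measure_spmf p) S = infsum (spmf p) S"
    using has_sum_spmf by (metis infsumI)
  also have "\<dots> = (\<Sum>\<^sub>\<infinity>\<gamma>\<in>S. z ^ sz \<gamma> * (1 / ogf C sz z))"
    using samp S by (intro infsum_cong) (auto simp: boltzmann_sampler_def)
  also have "\<dots> = ogf S sz z * (1 / ogf C sz z)"
    unfolding ogf_def[of S] by (rule infsum_cmult_left')
  finally show ?thesis by simp
qed

text \<open>The probabilities prescribed on \<open>C\<close> already sum to 1, so no mass is left
  for results outside \<open>C\<close> or for failure to terminate.\<close>

lemma boltzmann_sampler_support:
  assumes "boltzmann_sampler C sz z p" "z > 0" "(\<lambda>\<gamma>. z ^ sz \<gamma>) summable_on C" "C \<noteq> {}"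
  shows "set_spmf p \<subseteq> C" "weight_spmf p = 1"
proof -
  have C: "measure (measure_spmf p) C = 1"
    using boltzmann_sampler_measure[OF assms(1) order_refl] ogf_pos[OF assms(2-4)] by simp
  have "weight_spmf p = measure (measure_spmf p) C + measure (measure_spmf p) (- C)"
    unfolding weight_spmf_def
    by (subst measure_spmf.finite_measure_Union[symmetric]) auto
  with C weight_spmf_le_1[of p] have null: "measure (measure_spmf p) (- C) = 0"
    and "weight_spmf p = 1"
    using measure_nonneg[of "measure_spmf p" "- C"] by linarith+
  then show "weight_spmf p = 1" by simp
  from null show "set_spmf p \<subseteq> C" by (auto simp: measure_spmf_zero_iff)
qed

text \<open>Choosing a class with probability proportional to its generating function cancels that
  class's normalizing constant, so all elements share the constant of the union.\<close>

lemma boltzmann_sampler_Un: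
  assumes z: "z > 0" and disj: "C \<inter> D = {}" and ne: "C \<noteq> {}"
    and sumC: "(\<lambda>\<gamma>. z ^ sz \<gamma>) summable_on C" and sumD: "(\<lambda>\<gamma>. z ^ sz \<gamma>) summable_on D"
    and C: "boltzmann_sampler C sz z p" and D: "boltzmann_sampler D sz z q"
  shows "boltzmann_sampler (C \<union> D) sz z
    (bind_spmf (spmf_of_pmf (bernoulli_pmf (ogf C sz z / (ogf C sz z + ogf D sz z))))
      (\<lambda>b. if b then p else q))"
proof -
  let ?c = "ogf C sz z" and ?d = "ogf D sz z"
  let ?t = "?c / (?c + ?d)"
  have c: "?c > 0" using ogf_pos z sumC ne by blast
  have d: "?d \<ge> 0" using z unfolding ogf_def by (intro infsum_nonneg) auto
  have t: "0 \<le> ?t" "?t \<le> 1" "1 - ?t = ?d / (?c + ?d)" using c d by (auto simp: field_simps)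
  have mix: "spmf (bind_spmf (spmf_of_pmf (bernoulli_pmf ?t)) (\<lambda>b. if b then p else q)) \<gamma> =
      ?t * spmf p \<gamma> + (1 - ?t) * spmf q \<gamma>" for \<gamma>
    using t(1,2) by (simp add: bind_spmf_of_pmf pmf_bind mult.commute del: times_divide_eq_left times_divide_eq_right)
  have p0: "spmf p \<gamma> = 0" if "\<gamma> \<notin> C" for \<gamma>
    using boltzmann_sampler_support(1)[OF C z sumC ne] that by (auto simp: spmf_eq_0_set_spmf)
  \<comment> \<open>If \<open>D\<close> is empty then \<open>q\<close> is unconstrained, but it is chosen with probability 0.\<close>
  have q0: "(1 - ?t) * spmf q \<gamma> = 0" if "\<gamma> \<notin> D" for \<gamma>
  proof (cases "D = {}")
    case True
    then show ?thesis using c by (simp add: ogf_def)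
  next
    case False
    then show ?thesis
      using boltzmann_sampler_support(1)[OF D z sumD] that by (auto simp: spmf_eq_0_set_spmf)
  qed
  have "ogf (C \<union> D) sz z = ?c + ?d"
    unfolding ogf_def using sumC sumD disj by (rule infsum_Un_disjoint)
  moreover have "?t * spmf p \<gamma> + (1 - ?t) * spmf q \<gamma> = z ^ sz \<gamma> / (?c + ?d)" if "\<gamma> \<in> C \<union> D" for \<gamma>
  proof (cases "\<gamma> \<in> C")
    case True
    then have "\<gamma> \<notin> D" using disj by auto
    then show ?thesis using q0 True C c by (simp add: boltzmann_sampler_def)
  next
    case False
    then have "\<gamma> \<in> D" using that by auto
    then have "?d > 0" using ogf_pos[OF z sumD] by blast
    then show ?thesis using p0[OF False] \<open>\<gamma> \<in> D\<close> D t(3) by (simp add: boltzmann_sampler_def)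
  qed
  ultimately show ?thesis unfolding boltzmann_sampler_def mix by simp
qed

text \<open>Conditioning on \<open>P\<close> only rescales the weights. The size on \<open>C\<close>
  is pulled back along \<open>f\<close>, so the bijection preserves sizes and the accepted elements
  have the generating function of \<open>A\<close>.\<close>

lemma boltzmann_sampler_rejection:
  assumes z: "z > 0" and sumC: "(\<lambda>\<gamma>. z ^ sz (f \<gamma>)) summable_on C"
    and C: "boltzmann_sampler C (\<lambda>\<gamma>. sz (f \<gamma>)) z p"
    and bij: "bij_betw f {\<gamma> \<in> C. P \<gamma>} A"
  shows "boltzmann_sampler A sz z (map_spmf f (repeat_until p P))"
  unfolding boltzmann_sampler_def
proof
  fix T assume T: "T \<in> A"
  let ?c = "ogf C (\<lambda>\<gamma>. sz (f \<gamma>)) z" and ?S = "{\<gamma> \<in> C. P \<gamma>}" and ?F = "repeat_until p P"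
  obtain \<gamma> where \<gamma>: "\<gamma> \<in> C" "P \<gamma>" "T = f \<gamma>" using T bij by (auto simp: bij_betw_def)
  have ne: "C \<noteq> {}" and neS: "?S \<noteq> {}" using \<gamma> by auto
  have c: "?c > 0" using ogf_pos[OF z sumC ne] .
  have supp: "set_spmf p \<subseteq> C" and w: "weight_spmf p = 1"
    using boltzmann_sampler_support[OF C z sumC ne] by auto
  have a: "ogf ?S (\<lambda>\<gamma>. sz (f \<gamma>)) z = ogf A sz z"
    unfolding ogf_def by (rule infsum_reindex_bij_betw[OF bij])
  have "ogf ?S (\<lambda>\<gamma>. sz (f \<gamma>)) z > 0"
    using neS by (intro ogf_pos z summable_on_subset_banach[OF sumC]) auto
  with a have apos: "ogf A sz z > 0" by simp
  have "measure (measure_spmf p) UNIV =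
      measure (measure_spmf p) {y. P y} + measure (measure_spmf p) {y. \<not> P y}"
    by (subst measure_spmf.finite_measure_Union[symmetric]) (auto intro: arg_cong[where f = "measure _"])
  moreover have "measure (measure_spmf p) {y. P y} = measure (measure_spmf p) ?S"
    using supp by (intro measure_spmf.finite_measure_eq_AE) auto
  \<comment> \<open>The sampler loses no mass, so the complement of rejection is acceptance, whose
    probability is the ratio of the two generating functions.\<close>
  ultimately have acc: "1 - measure (measure_spmf p) {y. \<not> P y} = ogf A sz z / ?c"
    using w boltzmann_sampler_measure[OF C, of ?S] a by (simp add: weight_spmf_def)
  have F: "spmf ?F x * (ogf A sz z / ?c) = (if P x then spmf p x else 0)" for x
    using spmf_repeat_until[of p P x] acc by simp
  have F0: "spmf ?F x = 0" if "x \<notin> ?S" for x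
  proof -
    have "P x \<Longrightarrow> spmf p x = 0" using that supp by (auto simp: spmf_eq_0_set_spmf)
    then show ?thesis using F[of x] apos c by (auto split: if_splits)
  qed
  \<comment> \<open>\<open>f\<close> is known to be injective only on accepted elements, so the
    output of the loop is first confined to them.\<close>
  have "set_spmf ?F \<subseteq> ?S" using F0 unfolding in_set_spmf_iff_spmf subset_iff by blast
  then have inj: "inj_on f (set_spmf ?F)"
    using bij by (meson bij_betw_imp_inj_on inj_on_subset)
  have F\<gamma>: "spmf ?F \<gamma> = z ^ sz T / ogf A sz z"
    using F[of \<gamma>] C \<gamma> apos c by (simp add: boltzmann_sampler_def field_simps)
  then have "\<gamma> \<in> set_spmf ?F" using z apos by (simp add: in_set_spmf_iff_spmf)
  then show "spmf (map_spmf f ?F) T = z ^ sz T / ogf A sz z"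
    using spmf_map_inj[OF inj] F\<gamma> \<gamma>(3) by simp
qed

theorem mainTheorem1:
  fixes A :: "utree set" and sz :: "utree \<Rightarrow> nat" and z :: real
    and \<Gamma>v \<Gamma>e :: "rtree spmf"
  assumes finite_sizes: "\<And>n. finite {T \<in> A. sz T = n}"
    and z_pos: "z > 0"
    and conv_v: "(\<lambda>\<rho>. z ^ sz (unroot \<rho>)) summable_on vertex_rootings A"
    and conv_e: "(\<lambda>\<rho>. z ^ sz (unroot \<rho>)) summable_on edge_rootings A"
    and A_pos: "ogf A sz z > 0"
    and sampler_v: "boltzmann_sampler (vertex_rootings A) (\<lambda>\<rho>. sz (unroot \<rho>)) z \<Gamma>v"
    and sampler_e: "boltzmann_sampler (edge_rootings A) (\<lambda>\<rho>. sz (unroot \<rho>)) z \<Gamma>e"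
  shows "boltzmann_sampler A sz z
    (center_rejection
      (ogf (vertex_rootings A) (\<lambda>\<rho>. sz (unroot \<rho>)) z /
        (ogf (vertex_rootings A) (\<lambda>\<rho>. sz (unroot \<rho>)) z +
         ogf (edge_rootings A) (\<lambda>\<rho>. sz (unroot \<rho>)) z))
      \<Gamma>v \<Gamma>e)"
proof -
  \<comment> \<open>Mixing requires a nonempty first class. Every tree has a vertex to root at,
    whereas the class of edge rootings may be empty.\<close>
  have "A \<noteq> {}" using A_pos by (auto simp: ogf_def)
  then obtain T where T: "T \<in> A" by blast
  obtain G where G: "T = abs_utree G" "tree G" by (rule abs_utree_cases)
  then obtain v where "v \<in> verts G" by (auto simp: tree_def)
  then have ne: "vertex_rootings A \<noteq> {}" using T G unfolding vertex_rootings_def by blast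
  \<comment> \<open>The rejection lemma is applied with \<open>C\<close> the union of both kinds of
    rootings, \<open>P\<close> the center test and \<open>f\<close> forgetting the root.\<close>
  show ?thesis
    unfolding center_rejection_def
    by (rule boltzmann_sampler_rejection[OF z_pos _ _ bij_betw_unroot_center_rooted])
      (intro summable_on_Un_disjoint conv_v conv_e vertex_edge_rootings_disjoint
        boltzmann_sampler_Un z_pos ne sampler_v sampler_e)+
qed

end
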